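(* Let $Q\ge 2$, let $\alpha=(\alpha_1,\dots,\alpha_Q)$ be a probability vector and $\pi=(\pi_{qr})_{q,r\in[Q]}$ a symmetric matrix with entries in $[0,1]$, and assume that $\overline{\pi}_q\neq\overline{\pi}_r$ whenever $q\ne r$, where $\overline{\pi}_q=\sum_{r\in[Q]}\alpha_r\pi_{qr}$. Let $\delta=\min_{q\neq r}|\overline{\pi}_q-\overline{\pi}_r|$ and $\alpha_0=\min_{q\in[Q]}\alpha_q$. Let $n\ge 2$, let $(Z,X)$ be drawn from the Stochastic Block Model $\mathcal{G}(n,\pi,\alpha)$, and let $E_n$ be the event that the partition returned by the Largest Gaps (LG) algorithm with input $Q$ differs from the true partition. Then $$P(E_n)\le 2n\,e^{-\frac18 n\delta^2}+Q(1-\alpha_0)^{n}.$$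
   Context: Notation: $[n]=\{1,\dots,n\}$. Stochastic Block Model $\mathcal{G}(n,\pi,\alpha)$: the labels $Z_1,\dots,Z_n$ are i.i.d. in $[Q]$ with $P(Z_i=q)=\alpha_q$; $X$ is the adjacency matrix of an undirected graph on $[n]$ without self-loops ($X_{ij}=X_{ji}$), and conditionally on $Z$ the variables $X_{ij}$, $i<j$, are independent, $X_{ij}$ being Bernoulli with parameter $\pi_{Z_iZ_j}$. True classes: $\mathcal{C}_q=\{i\in[n]: Z_i=q\}$; the true partition is the set $\{\mathcal{C}_q\}_{q\in[Q]}$ (labels do not matter; if some class is empty, the empty set is one of its members). Normalized degrees: $T_i=\frac{1}{n-1}\sum_{j\ne i}X_{ij}$. LG algorithm with input $Q$: sort $T_{(1)}\le\dots\le T_{(n)}$ (here $(i)$ also denotes the node in position $i$ of the ordering); find indices $i_1<\dots<i_{Q-1}$ in $[n-1]$ of the $Q-1$ largest gaps, i.e. $T_{(i_k+1)}-T_{(i_k)}\ge T_{(i+1)}-T_{(i)}$ for all $k\in[Q-1]$ and all $i\in[n-1]\setminus\{i_1,\dots,i_{Q-1}\}$ (ties broken arbitrarily); with $i_0=0$, $i_Q=n$, the estimated class $\widehat{\mathcal{C}}_k$ is the set of nodes $(i)$ with $i_{k-1}<i\le i_k$. If $n<Q$ the algorithm is regarded as failing. The estimated partition is $\{\widehat{\mathcal{C}}_q\}_{q\in[Q]}$, and $E_n=\{\{\widehat{\mathcal{C}}_q\}_q\ne\{\mathcal{C}_q\}_q\}$. *)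

theory Defs
  imports "HOL-Probability.Probability"
begin

text \<open>
  Conventions: nodes are \<open>1, \<dots>, n\<close> and labels are \<open>1, \<dots>, Q\<close>; vectors and matrices over these
  index sets are functions on \<^typ>\<open>nat\<close> of which only the values on \<open>{1..n}\<close> and \<open>{1..Q}\<close>
  matter. A graph on the nodes is given by its adjacency relation.
\<close>

text \<open>
  The conditional law given \<open>Z = z\<close> is \<^const>\<open>uniform_measure\<close> of \<open>M\<close> on the event \<open>Z = z\<close>,
  i.e. \<open>A \<mapsto> P(A \<inter> {Z = z}) / P(Z = z)\<close>. Since \<open>Z\<close> is discrete, conditioning on \<open>Z\<close> means
  conditioning on each of its values of positive probability.
\<close>

locale stochastic_block_model = prob_space M for M :: "'w measure" +
  fixes n Q :: nat
    and \<pi> :: "nat \<Rightarrow> nat \<Rightarrow> real"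
    and \<alpha> :: "nat \<Rightarrow> real"
    and Z :: "nat \<Rightarrow> 'w \<Rightarrow> nat"
    and X :: "nat \<Rightarrow> nat \<Rightarrow> 'w \<Rightarrow> bool"
  assumes labels_indep: "indep_vars (\<lambda>_. count_space {1..Q}) Z {1..n}"
    and labels_distr:
      "\<And>i q. i \<in> {1..n} \<Longrightarrow> q \<in> {1..Q} \<Longrightarrow> prob {\<omega> \<in> space M. Z i \<omega> = q} = \<alpha> q"
    and edges_measurable:
      "\<And>i j. i \<in> {1..n} \<Longrightarrow> j \<in> {1..n} \<Longrightarrow> random_variable (count_space UNIV) (X i j)"
    and edges_sym:
      "\<And>i j \<omega>. i \<in> {1..n} \<Longrightarrow> j \<in> {1..n} \<Longrightarrow> \<omega> \<in> space M \<Longrightarrow> X i j \<omega> = X j i \<omega>"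
    and no_loops: "\<And>i \<omega>. i \<in> {1..n} \<Longrightarrow> \<omega> \<in> space M \<Longrightarrow> \<not> X i i \<omega>"
    and edges_cond_indep:
      "\<And>z. prob {\<omega> \<in> space M. \<forall>i\<in>{1..n}. Z i \<omega> = z i} > 0 \<Longrightarrow>
        prob_space.indep_vars
          (uniform_measure M {\<omega> \<in> space M. \<forall>i\<in>{1..n}. Z i \<omega> = z i})
          (\<lambda>_. count_space UNIV) (\<lambda>(i, j). X i j) {(i, j). 1 \<le> i \<and> i < j \<and> j \<le> n}"
    and edges_cond_distr:
      "\<And>z i j. prob {\<omega> \<in> space M. \<forall>i\<in>{1..n}. Z i \<omega> = z i} > 0 \<Longrightarrow>
        1 \<le> i \<Longrightarrow> i < j \<Longrightarrow> j \<le> n \<Longrightarrow>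
        distr (uniform_measure M {\<omega> \<in> space M. \<forall>i\<in>{1..n}. Z i \<omega> = z i})
          (count_space UNIV) (X i j) = measure_pmf (bernoulli_pmf (\<pi> (z i) (z j)))"

definition true_partition :: "nat \<Rightarrow> nat \<Rightarrow> (nat \<Rightarrow> nat) \<Rightarrow> nat set set" where
  "true_partition n Q z = (\<lambda>q. {i \<in> {1..n}. z i = q}) ` {1..Q}"

definition normalized_degree :: "nat \<Rightarrow> (nat \<Rightarrow> nat \<Rightarrow> bool) \<Rightarrow> nat \<Rightarrow> real" where
  "normalized_degree n x i = 1 / (real n - 1) * (\<Sum>j\<in>{1..n} - {i}. of_bool (x i j))"

text \<open>
  \<open>\<sigma> i\<close> is the node in position \<open>i\<close> of the ordering and \<open>c k\<close> is the cut index \<open>i\<^sub>k\<close>, including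
  the conventions \<open>i\<^sub>0 = 0\<close> and \<open>i\<^sub>Q = n\<close>. It is a relation rather than a function because ties,
  both in the sorting and in the choice of the gaps, are broken arbitrarily.
\<close>

definition LG_partition ::
    "nat \<Rightarrow> nat \<Rightarrow> (nat \<Rightarrow> nat \<Rightarrow> bool) \<Rightarrow> nat set set \<Rightarrow> bool" where
  "LG_partition n Q x P \<longleftrightarrow>
    (\<exists>\<sigma> c. let T = (\<lambda>i. normalized_degree n x (\<sigma> i)) in
      bij_betw \<sigma> {1..n} {1..n} \<and> mono_on {1..n} T \<and>
      strict_mono_on {0..Q} c \<and> c 0 = 0 \<and> c Q = n \<and>
      (\<forall>k\<in>{1..Q - 1}. \<forall>i\<in>{1..n - 1} - c ` {1..Q - 1}.
        T (c k + 1) - T (c k) \<ge> T (i + 1) - T i) \<and>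
      P = (\<lambda>k. \<sigma> ` {c (k - 1)<..c k}) ` {1..Q})"

text \<open>\<^const>\<open>None\<close> stands for failure of the algorithm.\<close>

definition LG_output ::
    "nat \<Rightarrow> nat \<Rightarrow> (nat \<Rightarrow> nat \<Rightarrow> bool) \<Rightarrow> nat set set option \<Rightarrow> bool" where
  "LG_output n Q x r \<longleftrightarrow>
    (if n < Q then r = None else (\<exists>P. r = Some P \<and> LG_partition n Q x P))"

definition mean_connectivity ::
    "nat \<Rightarrow> (nat \<Rightarrow> nat \<Rightarrow> real) \<Rightarrow> (nat \<Rightarrow> real) \<Rightarrow> nat \<Rightarrow> real" where
  "mean_connectivity Q \<pi> \<alpha> q = (\<Sum>r\<in>{1..Q}. \<alpha> r * \<pi> q r)"

definition min_separation ::
    "nat \<Rightarrow> (nat \<Rightarrow> nat \<Rightarrow> real) \<Rightarrow> (nat \<Rightarrow> real) \<Rightarrow> real" where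
  "min_separation Q \<pi> \<alpha> =
    Min {\<bar>mean_connectivity Q \<pi> \<alpha> q - mean_connectivity Q \<pi> \<alpha> r\<bar> | q r.
      q \<in> {1..Q} \<and> r \<in> {1..Q} \<and> q \<noteq> r}"

end

theory Submission
  imports Defs
begin

text \<open>
  If every class is nonempty and every normalized degree is within \<open>\<delta> / 4\<close> of its conditional mean,
  then gaps inside a class are smaller than \<open>\<delta> / 2\<close> and gaps between classes are larger, so the
  \<open>Q - 1\<close> largest gaps are the class boundaries. Given \<open>Z\<^sub>i = q\<close>, the degree of \<open>i\<close> is binomial
  with \<open>n - 1\<close> trials and success probability \<open>\<Sum>\<^sub>r \<alpha>\<^sub>r \<pi>\<^sub>q\<^sub>r\<close>, so Hoeffding's inequality would
  give the exponent \<open>(n - 1) \<delta>\<^sup>2 / 8\<close> instead of \<open>n \<delta>\<^sup>2 / 8\<close>. The missing factor is recovered from the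
  fourth-order term of the Bernoulli rate function: with \<open>e = \<delta> / 4 \<le> 1 / 4\<close>, unless the claimed
  bound exceeds 1 one has \<open>(n - 1) e\<^sup>2 \<ge> 3 / 2\<close>, and then \<open>(n - 1) (2 e\<^sup>2 + 4/3 e\<^sup>4) \<ge> 2 n e\<^sup>2\<close>.
  For means other than \<open>1 / 2\<close> one of the two tails may exceed \<open>exp (- 2 n e\<^sup>2)\<close>, but their sum
  does not exceed twice this value.
\<close>

section \<open>Two-sided Chernoff bound for Bernoulli variables\<close>

text \<open>For \<open>z \<ge> 0\<close> the ratio \<open>cosh z * exp (- z\<^sup>2 / 2)\<close>
  starts at 1 and decreases, because \<open>sinh z \<le> z * cosh z\<close>; evenness gives the
  rest. It serves to bound a sum of two tails whose exponents differ by an odd term.\<close>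

lemma cosh_le_exp_half_square:
  fixes z :: real
  shows "cosh z \<le> exp (z\<^sup>2 / 2)"
proof -
  have sinh_le: "sinh t \<le> t * cosh t" if "t \<ge> 0" for t :: real
  proof -
    have "0 * cosh 0 - sinh 0 \<le> t * cosh t - sinh t"
    proof (intro DERIV_nonneg_imp_nondecreasing[OF that])
      fix u :: real assume u: "0 \<le> u" "u \<le> t"
      have "((\<lambda>t. t * cosh t - sinh t) has_real_derivative u * sinh u) (at u)"
        by (auto intro!: derivative_eq_intros)
      moreover have "0 \<le> u * sinh u" using u by simp
      ultimately show "\<exists>y. ((\<lambda>t. t * cosh t - sinh t) has_real_derivative y) (at u) \<and> 0 \<le> y"
        by blast
    qed
    then show ?thesis by simp
  qed
  have pos: "cosh t \<le> exp (t\<^sup>2 / 2)" if "t \<ge> 0" for t :: real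
  proof -
    have "cosh t * exp (- t\<^sup>2 / 2) \<le> cosh 0 * exp (- 0\<^sup>2 / 2)"
    proof (intro DERIV_nonpos_imp_nonincreasing[OF that])
      fix u :: real assume u: "0 \<le> u" "u \<le> t"
      have "((\<lambda>t. cosh t * exp (- t\<^sup>2 / 2)) has_real_derivative
          (sinh u - u * cosh u) * exp (- u\<^sup>2 / 2)) (at u)"
        by (auto intro!: derivative_eq_intros simp: algebra_simps)
      moreover have "(sinh u - u * cosh u) * exp (- u\<^sup>2 / 2) \<le> 0"
        using sinh_le[OF u(1)] by (simp add: mult_nonpos_nonneg)
      ultimately show "\<exists>y. ((\<lambda>t. cosh t * exp (- t\<^sup>2 / 2)) has_real_derivative y) (at u) \<and> y \<le> 0"
        by blast
    qed
    then show ?thesis by (simp add: exp_minus field_simps)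
  qed
  show ?thesis using pos[of z] pos[of "- z"] by (cases "z \<ge> 0") auto
qed

text \<open>
  The rate is the relative entropy of Bernoulli(\<open>p + e\<close>) with respect to Bernoulli(\<open>p\<close>) with its
  second derivative \<open>1 / (y (1 - y))\<close>, \<open>y = p + e\<close>, replaced by the lower bound
  \<open>4 + 16 (y - 1/2)\<^sup>2\<close>; the tilt is the first derivative of the rate in \<open>e\<close>.
\<close>

definition bernoulli_tilt :: "real \<Rightarrow> real \<Rightarrow> real" where
  "bernoulli_tilt p e = 4 * e + 16 * (p - 1/2)\<^sup>2 * e + 16 * (p - 1/2) * e\<^sup>2 + 16/3 * e ^ 3"

definition bernoulli_rate :: "real \<Rightarrow> real \<Rightarrow> real" where
  "bernoulli_rate p e = 2 * e\<^sup>2 + 8 * (p - 1/2)\<^sup>2 * e\<^sup>2 + 16/3 * (p - 1/2) * e ^ 3 + 4/3 * e ^ 4"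

lemma bernoulli_tilt_0 [simp]: "bernoulli_tilt p 0 = 0"
  and bernoulli_rate_0 [simp]: "bernoulli_rate p 0 = 0"
  by (simp_all add: bernoulli_tilt_def bernoulli_rate_def)

lemma has_derivative_bernoulli_rate:
  "(bernoulli_rate p has_real_derivative bernoulli_tilt p e) (at e)"
  unfolding bernoulli_rate_def [abs_def] bernoulli_tilt_def
  by (auto intro!: derivative_eq_intros
      simp: power2_eq_square power3_eq_cube algebra_simps diff_divide_distrib add_divide_distrib)

lemma has_derivative_bernoulli_tilt:
  "(bernoulli_tilt p has_real_derivative 4 + 16 * (p + e - 1/2)\<^sup>2) (at e)"
  unfolding bernoulli_tilt_def [abs_def]
  by (auto intro!: derivative_eq_intros
      simp: power2_eq_square power3_eq_cube algebra_simps diff_divide_distrib add_divide_distrib)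

text \<open>Completing the square in \<open>p - 1/2\<close> uses 4 of the cubic coefficient 16/3,
  which shows the sign on both sides of \<open>p = 1/2\<close>.\<close>

lemma bernoulli_tilt_nonneg:
  assumes "e \<ge> 0"
  shows "bernoulli_tilt p e \<ge> 0"
proof -
  have "bernoulli_tilt p e = e * (4 + 16 * (p - 1/2 + e / 2)\<^sup>2 + 4/3 * e\<^sup>2)"
    by (simp add: bernoulli_tilt_def power2_eq_square power3_eq_cube algebra_simps)
  then show ?thesis using assms by simp
qed

text \<open>The mean of Bernoulli(\<open>p\<close>) tilted by \<open>s\<close> is
  \<open>p * exp s / (1 + p * (exp s - 1))\<close>; it equals \<open>p + e\<close> when
  \<open>s\<close> is the log odds of \<open>p + e\<close> minus the log odds of \<open>p\<close>.
  The polynomial tilt is at most that difference, since its derivative is at most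
  \<open>1 / (y * (1 - y))\<close> at \<open>y = p + e\<close>.\<close>

lemma bernoulli_tilted_mean_le:
  assumes p: "0 \<le> p" "p \<le> 1" and e: "e \<ge> 0"
  shows "p * exp (bernoulli_tilt p e) \<le> (p + e) * (1 + p * (exp (bernoulli_tilt p e) - 1))"
proof -
  let ?s = "bernoulli_tilt p"
  have "p * exp (?s e) * (1 - p - e) \<le> (p + e) * (1 - p)"
  \<comment> \<open>Both log odds are finite only in the first case; otherwise the left side is
    nonpositive and the right side nonnegative.\<close>
  proof (cases "0 < p \<and> p + e < 1")
    case True
    define h where "h = (\<lambda>t. ln (p + t) - ln (1 - p - t) - ?s t)"
    have "h 0 \<le> h e"
    proof (intro DERIV_nonneg_imp_nondecreasing[OF e])
      fix t assume t: "0 \<le> t" "t \<le> e"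
      define y where "y = p + t - 1/2"
      have y: "0 < 1/2 + y" "0 < 1/2 - y" using t True by (auto simp: y_def)
      have "((\<lambda>t. ln (p + t)) has_real_derivative 1 / (p + t)) (at t)"
        "((\<lambda>t. ln (1 - p - t)) has_real_derivative - (1 / (1 - p - t))) (at t)"
        using t True by (auto intro!: derivative_eq_intros)
      from DERIV_diff[OF DERIV_diff[OF this] has_derivative_bernoulli_tilt[of p]]
      have "(h has_real_derivative (1 / (p + t) + 1 / (1 - p - t) - (4 + 16 * (p + t - 1/2)\<^sup>2))) (at t)"
        unfolding h_def by (simp only: diff_minus_eq_add)
      also have "1 / (p + t) + 1 / (1 - p - t) - (4 + 16 * (p + t - 1/2)\<^sup>2)
          = 1 / (1/2 + y) + 1 / (1/2 - y) - (4 + 16 * y\<^sup>2)"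
        by (simp add: y_def)
      finally have "(h has_real_derivative (1 / (1/2 + y) + 1 / (1/2 - y) - (4 + 16 * y\<^sup>2))) (at t)" .
      moreover have "4 + 16 * y\<^sup>2 \<le> 1 / (1/2 + y) + 1 / (1/2 - y)"
      proof -
        \<comment> \<open>With \<open>y\<close> measured from 1/2 the quadratic terms cancel, so
          only a fourth-order term is lost.\<close>
        have "(4 + 16 * y\<^sup>2) * ((1/2 + y) * (1/2 - y)) = 1 - 16 * (y\<^sup>2)\<^sup>2"
          by (simp add: power2_eq_square algebra_simps)
        then have "4 + 16 * y\<^sup>2 \<le> 1 / ((1/2 + y) * (1/2 - y))"
          using y by (subst pos_le_divide_eq) auto
        also have "\<dots> = 1 / (1/2 + y) + 1 / (1/2 - y)"
          using y by (subst add_frac_eq) auto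
        finally show ?thesis .
      qed
      ultimately show "\<exists>d. (h has_real_derivative d) (at t) \<and> 0 \<le> d"
        by (intro exI conjI) auto
    qed
    then have "?s e \<le> ln ((p + e) * (1 - p) / (p * (1 - p - e)))"
      using True e by (simp add: h_def ln_div ln_mult)
    then have "exp (?s e) \<le> (p + e) * (1 - p) / (p * (1 - p - e))"
      using True e by (subst (asm) ln_ge_iff) auto
    then show ?thesis
      using True by (simp add: pos_le_divide_eq mult_ac)
  next
    case False
    have "p * exp (?s e) * (1 - p - e) \<le> 0"
      using False p by (cases "p = 0") (auto intro!: mult_nonneg_nonpos)
    also have "0 \<le> (p + e) * (1 - p)" using p e by simp
    finally show ?thesis .
  qed
  then show ?thesis by (simp add: algebra_simps)
qed

text \<open>Both sides equal 1 at \<open>e = 0\<close>, and the logarithm of their quotient is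
  monotone in \<open>e\<close> by \<open>bernoulli_tilted_mean_le\<close>. The left side is the
  one-trial factor of Chernoff's bound at level \<open>p + e\<close>.\<close>

lemma bernoulli_mgf_bound:
  assumes p: "0 \<le> p" "p \<le> 1" and e: "e \<ge> 0"
  shows "exp (- bernoulli_tilt p e * (p + e)) * (1 + p * (exp (bernoulli_tilt p e) - 1))
    \<le> exp (- bernoulli_rate p e)"
proof -
  let ?s = "bernoulli_tilt p"
  define m where "m = (\<lambda>t. 1 + p * (exp (?s t) - 1))"
  have m_pos: "m t > 0" for t
  proof (cases "p = 1")
    case False
    have "m t = (1 - p) + p * exp (?s t)" by (simp add: m_def algebra_simps)
    then show ?thesis using p False by (simp add: add_pos_nonneg)
  qed (simp add: m_def)
  define G where "G = (\<lambda>t. ?s t * (p + t) - bernoulli_rate p t - ln (m t))"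
  have "G 0 \<le> G e"
  proof (intro DERIV_nonneg_imp_nondecreasing[OF e])
    fix t assume t: "0 \<le> t" "t \<le> e"
    \<comment> \<open>The tilt is the derivative of the rate, so these two contributions cancel and
      the derivative of the tilt remains as a positive factor.\<close>
    have "(G has_real_derivative
        (4 + 16 * (p + t - 1/2)\<^sup>2) * (p + t - p * exp (?s t) / m t)) (at t)"
      unfolding G_def m_def using m_pos[of t]
      by (auto intro!: derivative_eq_intros has_derivative_bernoulli_tilt
          has_derivative_bernoulli_rate simp: m_def diff_divide_distrib algebra_simps)
    moreover have "p * exp (?s t) / m t \<le> p + t"
      using bernoulli_tilted_mean_le[OF p t(1)] m_pos[of t]
      by (simp add: pos_divide_le_eq m_def)
    ultimately show "\<exists>d. (G has_real_derivative d) (at t) \<and> 0 \<le> d"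
      by (intro exI conjI) auto
  qed
  then have "ln (m e) \<le> ?s e * (p + e) - bernoulli_rate p e"
    by (simp add: G_def m_def)
  then have "m e \<le> exp (?s e * (p + e) - bernoulli_rate p e)"
    using m_pos[of e] by (metis exp_le_cancel_iff exp_ln)
  then have "exp (- ?s e * (p + e)) * m e
      \<le> exp (- ?s e * (p + e)) * exp (?s e * (p + e) - bernoulli_rate p e)"
    by (intro mult_left_mono) auto
  also have "\<dots> = exp (- bernoulli_rate p e)" by (simp flip: exp_add)
  finally show ?thesis by (simp add: m_def)
qed

text \<open>Replacing \<open>p\<close> by \<open>1 - p\<close> changes only the sign of the odd term
  of the rate. If \<open>m * e\<^sup>2\<close> is large, each tail absorbs this term alone;
  otherwise it is averaged in the sum through \<open>cosh\<close>.\<close>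

lemma two_sided_rate_bound:
  fixes m e p :: real
  assumes e: "0 \<le> e" "e \<le> 1/4" and m: "m * e\<^sup>2 \<ge> 3/2"
  shows "exp (- m * bernoulli_rate p e) + exp (- m * bernoulli_rate (1 - p) e)
    \<le> 2 * exp (- 2 * (m + 1) * e\<^sup>2)"
proof -
  define x where "x = p - 1/2"
  have rates: "bernoulli_rate p e = 2 * e\<^sup>2 + 8 * x\<^sup>2 * e\<^sup>2 + 4/3 * e ^ 4 + 16/3 * x * e ^ 3"
    "bernoulli_rate (1 - p) e = 2 * e\<^sup>2 + 8 * x\<^sup>2 * e\<^sup>2 + 4/3 * e ^ 4 - 16/3 * x * e ^ 3"
    by (simp_all add: bernoulli_rate_def x_def power2_eq_square algebra_simps diff_divide_distrib add_divide_distrib)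
  have e2: "e\<^sup>2 \<le> 1/16" using power_mono[OF e(2,1), of 2] by (simp add: power2_eq_square)
  have m0: "m \<ge> 0"
  proof (rule ccontr)
    assume "\<not> m \<ge> 0"
    then have "m * e\<^sup>2 \<le> 0" by (simp add: mult_nonpos_nonneg)
    then show False using m by simp
  qed
  show ?thesis
  proof (cases "m * e\<^sup>2 \<ge> 9/2")
    case True
    \<comment> \<open>Completing the square absorbs the odd term and takes 8/9 out of the quartic
      coefficient 4/3. The remaining 4/9 yields the missing \<open>2 * e\<^sup>2\<close> as soon as
      \<open>m * e\<^sup>2 \<ge> 9/2\<close>, hence the threshold.\<close>
    have "8 * (x * e + e\<^sup>2 / 3)\<^sup>2 \<ge> 0" "8 * (x * e - e\<^sup>2 / 3)\<^sup>2 \<ge> 0" by auto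
    then have r: "bernoulli_rate p e \<ge> 2 * e\<^sup>2 + 4/9 * e ^ 4"
      "bernoulli_rate (1 - p) e \<ge> 2 * e\<^sup>2 + 4/9 * e ^ 4"
      unfolding rates by (simp_all add: power2_eq_square power3_eq_cube power4_eq_xxxx algebra_simps)
    have "4/9 * (m * e\<^sup>2) * e\<^sup>2 \<ge> 4/9 * (9/2) * e\<^sup>2"
      using True by (intro mult_right_mono) auto
    then have "2 * (m + 1) * e\<^sup>2 \<le> m * (2 * e\<^sup>2 + 4/9 * e ^ 4)"
      by (simp add: power2_eq_square power4_eq_xxxx algebra_simps)
    then have "2 * (m + 1) * e\<^sup>2 \<le> m * bernoulli_rate p e"
      "2 * (m + 1) * e\<^sup>2 \<le> m * bernoulli_rate (1 - p) e"
      using mult_left_mono[OF r(1) m0] mult_left_mono[OF r(2) m0] by linarith+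
    then have "exp (- m * bernoulli_rate p e) \<le> exp (- 2 * (m + 1) * e\<^sup>2)"
      "exp (- m * bernoulli_rate (1 - p) e) \<le> exp (- 2 * (m + 1) * e\<^sup>2)"
      unfolding exp_le_cancel_iff by linarith+
    then show ?thesis by linarith
  next
    case False
    define c where "c = m * (2 * e\<^sup>2 + 8 * x\<^sup>2 * e\<^sup>2 + 4/3 * e ^ 4)"
    define z where "z = 16/3 * m * x * e ^ 3"
    have "exp (- m * bernoulli_rate p e) + exp (- m * bernoulli_rate (1 - p) e)
        = exp (- c - z) + exp (- c + z)"
      unfolding rates c_def z_def by (simp add: algebra_simps)
    also have "\<dots> = 2 * exp (- c) * cosh z"
      by (simp add: cosh_field_def exp_add exp_diff exp_minus field_simps)
    also have "\<dots> \<le> 2 * exp (- c) * exp (z\<^sup>2 / 2)"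
      by (intro mult_left_mono cosh_le_exp_half_square) auto
    also have "\<dots> = 2 * exp (z\<^sup>2 / 2 - c)" by (simp flip: exp_add)
    \<comment> \<open>The term \<open>z\<^sup>2 / 2\<close> is paid for by the part
      \<open>8 * x\<^sup>2 * e\<^sup>2\<close> of the rate, for which
      \<open>m * e ^ 4 \<le> 9/16\<close> suffices. The quartic part and
      \<open>m * e\<^sup>2 \<ge> 3/2\<close> then supply the extra
      \<open>2 * e\<^sup>2\<close>.\<close>
    also have "z\<^sup>2 / 2 - c \<le> - 2 * (m + 1) * e\<^sup>2"
    proof -
      have "(m * e\<^sup>2) * e\<^sup>2 \<le> 9/2 * (1/16)"
        using False e2 by (intro mult_mono) auto
      then have "128/9 * (m * e\<^sup>2 * e\<^sup>2) \<le> 8" by linarith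
      then have "128/9 * (m * e\<^sup>2 * e\<^sup>2) * (m * x\<^sup>2 * e\<^sup>2) \<le> 8 * (m * x\<^sup>2 * e\<^sup>2)"
        using m0 by (intro mult_right_mono) auto
      moreover have "z\<^sup>2 / 2 = 128/9 * (m * e\<^sup>2 * e\<^sup>2) * (m * x\<^sup>2 * e\<^sup>2)"
        by (simp add: z_def power2_eq_square power3_eq_cube)
      moreover have "4/3 * (m * e\<^sup>2) * e\<^sup>2 \<ge> 4/3 * (3/2) * e\<^sup>2"
        using m by (intro mult_right_mono) auto
      ultimately show ?thesis
        by (simp add: c_def power4_eq_xxxx power2_eq_square algebra_simps)
    qed
    finally show ?thesis by simp
  qed
qed

text \<open>A bound below 1 means \<open>ln (2 * real n) < 2 * real n * e\<^sup>2\<close>, so a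
  numerical lower bound on the logarithm bounds \<open>real n * e\<^sup>2\<close> from below.
  Passing to \<open>real n - 1\<close> costs only \<open>e\<^sup>2 \<le> 1/16\<close>.\<close>

lemma mult_square_ge_of_tail_nontrivial:
  fixes e :: real and n :: nat
  assumes n: "n \<ge> 2" and e: "0 \<le> e" "e \<le> 1/4" and lt: "2 * real n * exp (- 2 * real n * e\<^sup>2) < 1"
  shows "(real n - 1) * e\<^sup>2 \<ge> 3/2"
proof -
  have e2: "e\<^sup>2 \<le> 1/16" using power_mono[OF e(2,1), of 2] by (simp add: power2_eq_square)
  have "2 * real n < exp (2 * real n * e\<^sup>2)"
    using lt by (simp add: exp_minus field_simps)
  then have ln_less: "ln (2 * real n) < 2 * real n * e\<^sup>2"
    using n by (metis exp_less_cancel_iff exp_ln less_numeral_extra(1) mult_pos_pos of_nat_0_less_iff order_less_le_trans pos2 zero_less_numeral)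
  have "real n * e\<^sup>2 \<le> real n * (1/16)" using e2 by (intro mult_left_mono) auto
  then have ln_less': "ln (2 * real n) < real n / 8" using ln_less by simp
  \<comment> \<open>Powers of 2 and \<open>ln 2 \<ge> 2/3\<close> turn the logarithm into rational
    lower bounds.\<close>
  have ge: "ln (2 * real n) \<ge> real k * (2/3)" if "2 ^ k \<le> 2 * n" for k :: nat
  proof -
    have "real k * (2/3) \<le> real k * ln 2" using ln2_ge_two_thirds by (intro mult_left_mono) auto
    also have "\<dots> = ln (2 ^ k)" by (simp add: ln_realpow)
    also have "\<dots> \<le> ln (2 * real n)"
      using of_nat_mono[OF that, where ?'a = real] n by (subst ln_le_cancel_iff) auto
    finally show ?thesis .
  qed
  \<comment> \<open>Bootstrapping: \<open>ln (2 n) < n / 8\<close> fails for \<open>n < 11\<close>, which improves the lower bound on \<open>ln (2 n)\<close>.\<close>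
  have "n \<ge> 11" using ge[of 2] ln_less' n by simp
  then have "n \<ge> 22" using ge[of 4] ln_less' by simp
  \<comment> \<open>Now \<open>32 \<le> 2 * n\<close>, and \<open>5/3 - 1/16\<close> exceeds
    3/2.\<close>
  then have "2 * real n * e\<^sup>2 \<ge> 10/3" using ge[of 5] ln_less by simp
  then show ?thesis using e2 by (simp add: algebra_simps)
qed

section \<open>Correctness of the largest gaps under concentration\<close>

text \<open>The least \<open>k\<close> with \<open>i \<le> c k\<close> gives the block of position
  \<open>i\<close>.\<close>

lemma consecutive_block_exists:
  fixes c :: "nat \<Rightarrow> nat"
  assumes "c 0 < i" "i \<le> c Q"
  obtains k where "k \<in> {1..Q}" "c (k - 1) < i" "i \<le> c k"
proof -
  define k where "k = (LEAST k. i \<le> c k)"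
  have k: "i \<le> c k" unfolding k_def using assms(2) by (rule LeastI)
  have "k \<le> Q" unfolding k_def using assms(2) by (rule Least_le)
  moreover have "k \<noteq> 0" using k assms(1) by (metis not_le)
  moreover have "\<not> i \<le> c (k - 1)"
    using not_less_Least[of "k - 1" "\<lambda>k. i \<le> c k"] \<open>k \<noteq> 0\<close> unfolding k_def by simp
  ultimately show thesis using k that[of k] by auto
qed

lemma constant_on_consecutive:
  fixes l :: "nat \<Rightarrow> 'a" and a b :: nat
  assumes "a \<le> b" "\<And>i. a \<le> i \<Longrightarrow> i < b \<Longrightarrow> l i = l (Suc i)"
  shows "l a = l b"
  using assms by (induction b rule: dec_induct) auto

text \<open>Sorting by degree makes each class a run of consecutive positions, so at most
  \<open>Q - 1\<close> label changes occur. Gaps at label changes exceed \<open>2 * e\<close> and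
  all others are smaller; as there are \<open>Q - 1\<close> cuts, every label change is a
  cut.\<close>

lemma LG_partition_eq_true_partition:
  assumes LG: "LG_partition n Q x P" and "Q \<ge> 2"
    and lab: "\<And>i. i \<in> {1..n} \<Longrightarrow> z i \<in> {1..Q}"
    and nonempty: "\<And>q. q \<in> {1..Q} \<Longrightarrow> \<exists>i\<in>{1..n}. z i = q"
    and sep: "\<And>q r. q \<in> {1..Q} \<Longrightarrow> r \<in> {1..Q} \<Longrightarrow> q \<noteq> r \<Longrightarrow> \<bar>p q - p r\<bar> \<ge> 4 * e"
    and conc: "\<And>i. i \<in> {1..n} \<Longrightarrow> \<bar>normalized_degree n x i - p (z i)\<bar> < e"
  shows "P = true_partition n Q z"
proof -
  obtain \<sigma> c where \<sigma>: "bij_betw \<sigma> {1..n} {1..n}"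
    and T_mono: "mono_on {1..n} (\<lambda>i. normalized_degree n x (\<sigma> i))"
    and c_mono: "strict_mono_on {0..Q} c" and c0: "c 0 = 0" and cQ: "c Q = n"
    and gaps: "\<forall>k\<in>{1..Q - 1}. \<forall>i\<in>{1..n - 1} - c ` {1..Q - 1}.
      normalized_degree n x (\<sigma> (c k + 1)) - normalized_degree n x (\<sigma> (c k))
      \<ge> normalized_degree n x (\<sigma> (i + 1)) - normalized_degree n x (\<sigma> i)"
    and P: "P = (\<lambda>k. \<sigma> ` {c (k - 1)<..c k}) ` {1..Q}"
    using LG unfolding LG_partition_def Let_def by (elim exE conjE) (rule that)
  define T where "T = (\<lambda>i. normalized_degree n x (\<sigma> i))"
  define l where "l = (\<lambda>i. z (\<sigma> i))"
  have \<sigma>_in: "\<sigma> i \<in> {1..n}" if "i \<in> {1..n}" for i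
    using \<sigma> that by (auto simp: bij_betw_def)
  have \<sigma>_surj: "\<exists>j\<in>{1..n}. i = \<sigma> j" if "i \<in> {1..n}" for i
    using bij_betw_imp_surj_on[OF \<sigma>] that by blast
  have l_in: "l i \<in> {1..Q}" if "i \<in> {1..n}" for i
    using lab \<sigma>_in that by (simp add: l_def)
  have T_close: "\<bar>T i - p (l i)\<bar> < e" if "i \<in> {1..n}" for i
    using conc \<sigma>_in that by (simp add: T_def l_def)
  have T_le: "T i \<le> T j" if "i \<in> {1..n}" "j \<in> {1..n}" "i \<le> j" for i j
    using T_mono that by (auto simp: mono_on_def T_def)
  \<comment> \<open>A reversed pair would have means at least \<open>4 * e\<close> apart, which two
    errors below \<open>e\<close> cannot turn around.\<close>
  have p_l_mono: "p (l i) \<le> p (l j)" if ij: "i \<in> {1..n}" "j \<in> {1..n}" "i \<le> j" for i j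
  proof (rule ccontr)
    assume *: "\<not> p (l i) \<le> p (l j)"
    then have "l i \<noteq> l j" by auto
    then have "\<bar>p (l i) - p (l j)\<bar> \<ge> 4 * e" using sep l_in ij by blast
    then show False using * T_le[OF ij] T_close[OF ij(1)] T_close[OF ij(2)] by linarith
  qed
  have n1: "n \<ge> 1" using nonempty[of 1] \<open>Q \<ge> 2\<close> by force
  \<comment> \<open>Distinctness of the means needs \<open>e > 0\<close>, which the strict error
    bound at position 1 supplies.\<close>
  have p_inj: "q = r" if "q \<in> {1..Q}" "r \<in> {1..Q}" "p q = p r" for q r
  proof (rule ccontr)
    assume "q \<noteq> r"
    then have "e \<le> 0" using sep[of q r] that by simp
    then show False using T_close[of 1] n1 by simp
  qed
  \<comment> \<open>Monotonicity squeezes \<open>p (l j)\<close> between equal values: each label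
    occupies an interval of positions.\<close>
  have l_between: "l i = l j"
    if "i \<in> {1..n}" "k \<in> {1..n}" "i \<le> j" "j \<le> k" "l i = l k" for i j k
    using p_l_mono[of i j] p_l_mono[of j k] that by (intro p_inj l_in) auto
  \<comment> \<open>\<open>B\<close> marks a label change by the position before the gap, as the
    cuts do.\<close>
  define B where "B = {i \<in> {1..n - 1}. l i \<noteq> l (Suc i)}"
  have B_in: "i \<in> {1..n}" "Suc i \<in> {1..n}" if "i \<in> B" for i
    using that n1 by (auto simp: B_def)
  \<comment> \<open>A label once left never returns, so the labels entered at the changes are
    distinct and differ from the label \<open>l 1\<close> of the first run.\<close>
  have "inj_on (\<lambda>i. l (Suc i)) B"
  proof (rule linorder_inj_onI)
    fix i j assume "i < j" "i \<in> B" "j \<in> B"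
    then show "l (Suc i) \<noteq> l (Suc j)"
      using l_between[of "Suc i" "Suc j" j] B_in[of i] B_in[of j] by (auto simp: B_def)
  qed auto
  moreover have "(\<lambda>i. l (Suc i)) ` B \<subseteq> {1..Q} - {l 1}"
  proof safe
    fix i assume i: "i \<in> B"
    show "l (Suc i) \<in> {1..Q}" using B_in[OF i] by (intro l_in)
    show False if "l (Suc i) = l 1"
      using l_between[of 1 "Suc i" i] that i B_in[OF i] n1 by (auto simp: B_def)
  qed
  ultimately have cardB: "card B \<le> Q - 1"
    using card_inj_on_le[of _ B "{1..Q} - {l 1}"] l_in[of 1] n1 by auto
  let ?C = "c ` {1..Q - 1}"
  have c_less: "c i < c j" if "i < j" "j \<le> Q" for i j
    using c_mono that by (auto simp: strict_mono_on_def)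
  have c_le: "c i \<le> c j" if "i \<le> j" "j \<le> Q" for i j
    using c_less[of i j] that by (cases "i = j") auto
  have "inj_on c {1..Q - 1}"
    using c_mono by (rule inj_on_subset[OF strict_mono_on_imp_inj_on]) auto
  then have cardC: "card ?C = Q - 1" by (simp add: card_image)
  have C_sub: "?C \<subseteq> {1..n - 1}"
  proof safe
    fix k assume "k \<in> {1..Q - 1}"
    then have "0 < k" "k < Q" "k \<le> Q" by auto
    then have "0 < c k" "c k < n" using c_less[of 0 k] c_less[of k Q] c0 cQ by auto
    then show "c k \<in> {1..n - 1}" by auto
  qed
  have "B \<subseteq> ?C"
  proof (rule ccontr)
    assume "\<not> B \<subseteq> ?C"
    then obtain i where i: "i \<in> B" "i \<notin> ?C" by blast
    \<comment> \<open>\<open>?C\<close> has \<open>Q - 1\<close> elements and \<open>B\<close> has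
      no more. A change that is not a cut therefore forces a cut that is not a change, whose gap is
      too small to be preferred.\<close>
    have "\<not> ?C \<subset> B"
      using psubset_card_mono[of B ?C] cardB cardC by (auto simp: B_def)
    then obtain k where k: "k \<in> {1..Q - 1}" "c k \<notin> B" using i by blast
    have ck: "c k \<in> {1..n - 1}" using C_sub k by blast
    have "T (Suc (c k)) - T (c k) \<ge> T (Suc i) - T i"
      using bspec[OF bspec[OF gaps k(1)], of i] i by (auto simp: B_def T_def)
    moreover have lab_eq: "l (c k) = l (Suc (c k))" using k ck by (simp add: B_def)
    moreover have "\<bar>p (l i) - p (l (Suc i))\<bar> \<ge> 4 * e"
      using i B_in[of i] by (intro sep l_in) (auto simp: B_def)
    moreover have "T i \<le> T (Suc i)" using i B_in[of i] by (intro T_le) auto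
    moreover have "\<bar>T i - p (l i)\<bar> < e" "\<bar>T (Suc i) - p (l (Suc i))\<bar> < e"
      using i B_in[of i] by (auto intro!: T_close)
    moreover have "\<bar>T (c k) - p (l (c k))\<bar> < e" "\<bar>T (Suc (c k)) - p (l (c k))\<bar> < e"
      using ck T_close[of "c k"] T_close[of "Suc (c k)"] lab_eq by auto
    ultimately show False by linarith
  qed
  have block_label: "l i = l (c k)" if k: "k \<in> {1..Q}" and i: "i \<in> {c (k - 1)<..c k}" for k i
  proof (rule constant_on_consecutive[where l = l])
    fix j assume j: "i \<le> j" "j < c k"
    \<comment> \<open>The strict bound \<open>j < c k\<close> matters: the last position
      \<open>c k\<close> of a block is itself a cut unless \<open>k = Q\<close>.\<close>
    have "j \<notin> ?C"
    proof
      assume "j \<in> ?C"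
      then obtain k' where k': "k' \<in> {1..Q - 1}" "j = c k'" by blast
      then have "c (k - 1) < c k'" "c k' < c k" using i j by auto
      moreover have "k' \<le> Q" "k - 1 \<le> Q" using k k'(1) by auto
      ultimately have "\<not> k' \<le> k - 1" "\<not> k \<le> k'"
        using c_le[of k' "k - 1"] c_le[of k k'] by linarith+
      then show False by simp
    qed
    moreover have "c k \<le> n" using c_le[of k Q] k cQ by auto
    with i j have "j \<in> {1..n - 1}" by auto
    ultimately show "l j = l (Suc j)" using \<open>B \<subseteq> ?C\<close> by (auto simp: B_def)
  qed (use i in auto)
  have blocks: "\<exists>k\<in>{1..Q}. i \<in> {c (k - 1)<..c k}" if "i \<in> {1..n}" for i
  proof -
    have "c 0 < i" "i \<le> c Q" using that c0 cQ by auto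
    then obtain k where "k \<in> {1..Q}" "c (k - 1) < i" "i \<le> c k"
      by (rule consecutive_block_exists)
    then show ?thesis by auto
  qed
  \<comment> \<open>The label of a block is read at its last position.\<close>
  define f where "f = (\<lambda>k. l (c k))"
  have c_in: "c k \<in> {1..n}" if "k \<in> {1..Q}" for k
    using that c_less[of 0 k] c_less[of k Q] c0 cQ by (cases "k = Q") auto
  have f_surj: "f ` {1..Q} = {1..Q}"
  proof (intro equalityI subsetI)
    fix q assume "q \<in> {1..Q}"
    then obtain i where i: "i \<in> {1..n}" "z i = q" using nonempty by blast
    then obtain j where j: "j \<in> {1..n}" "i = \<sigma> j" using \<sigma>_surj by blast
    then obtain k where k: "k \<in> {1..Q}" "j \<in> {c (k - 1)<..c k}" using blocks by blast
    then have "q = f k" using block_label[of k j] i j by (simp add: f_def l_def)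
    then show "q \<in> f ` {1..Q}" using k(1) by blast
  qed (use l_in c_in in \<open>auto simp: f_def\<close>)
  \<comment> \<open>A map of a finite set onto itself is injective, so no class is split over two
    blocks.\<close>
  then have f_inj: "inj_on f {1..Q}" by (intro eq_card_imp_inj_on) (simp_all only: finite_atLeastAtMost)
  have block_eq: "\<sigma> ` {c (k - 1)<..c k} = {i \<in> {1..n}. z i = f k}" if k: "k \<in> {1..Q}" for k
  proof safe
    fix j assume j: "j \<in> {c (k - 1)<..c k}"
    then have "j \<in> {1..n}" using c_in[OF k] by auto
    then show "\<sigma> j \<in> {1..n}" by (rule \<sigma>_in)
    show "z (\<sigma> j) = f k" using block_label[OF k j] by (simp add: l_def f_def)
  next
    fix i assume i: "i \<in> {1..n}" "z i = f k"
    then obtain j where j: "j \<in> {1..n}" "i = \<sigma> j" using \<sigma>_surj by blast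
    then obtain k' where k': "k' \<in> {1..Q}" "j \<in> {c (k' - 1)<..c k'}" using blocks by blast
    then have "f k' = f k" using block_label[of k' j] i j by (simp add: f_def l_def)
    then have "k' = k" using f_inj k k' by (auto dest: inj_onD)
    then show "i \<in> \<sigma> ` {c (k - 1)<..c k}" using k' j by blast
  qed
  have "P = (\<lambda>k. {i \<in> {1..n}. z i = f k}) ` {1..Q}"
    unfolding P using block_eq by (intro image_cong) auto
  also have "\<dots> = (\<lambda>q. {i \<in> {1..n}. z i = q}) ` f ` {1..Q}" by (simp add: image_image)
  finally show ?thesis by (simp only: f_surj true_partition_def)
qed

section \<open>Degree concentration in the stochastic block model\<close>

locale sbm_parameters = stochastic_block_model +
  assumes nodes: "n \<ge> 2"
    and \<alpha>_nonneg: "\<And>q. q \<in> {1..Q} \<Longrightarrow> \<alpha> q \<ge> 0"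
    and \<alpha>_sum: "(\<Sum>q\<in>{1..Q}. \<alpha> q) = 1"
    and \<pi>_range: "\<And>q r. q \<in> {1..Q} \<Longrightarrow> r \<in> {1..Q} \<Longrightarrow> \<pi> q r \<in> {0..1}"
    and \<pi>_sym: "\<And>q r. q \<in> {1..Q} \<Longrightarrow> r \<in> {1..Q} \<Longrightarrow> \<pi> q r = \<pi> r q"
begin

abbreviation mean_conn :: "nat \<Rightarrow> real" where
  "mean_conn \<equiv> mean_connectivity Q \<pi> \<alpha>"

definition labels_event :: "(nat \<Rightarrow> nat) \<Rightarrow> 'a set" where
  "labels_event z = {\<omega> \<in> space M. \<forall>i\<in>{1..n}. Z i \<omega> = z i}"

text \<open>Left without normalization so that its exponential is a product over edges.\<close>

definition node_degree :: "nat \<Rightarrow> 'a \<Rightarrow> real" where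
  "node_degree i \<omega> = (\<Sum>j\<in>{1..n} - {i}. of_bool (X i j \<omega>))"

lemma normalized_degree_eq: "normalized_degree n (\<lambda>i j. X i j \<omega>) i = node_degree i \<omega> / (real n - 1)"
  by (simp add: normalized_degree_def node_degree_def)

section \<open>Measurability, law of the labels, and empty classes\<close>

lemma label_measurable: "i \<in> {1..n} \<Longrightarrow> Z i \<in> measurable M (count_space {1..Q})"
  using labels_indep by (auto simp: indep_vars_def)

lemma label_in: "i \<in> {1..n} \<Longrightarrow> \<omega> \<in> space M \<Longrightarrow> Z i \<omega> \<in> {1..Q}"
  using measurable_space[OF label_measurable] by simp

lemma label_set_measurable [measurable]:
  assumes "i \<in> {1..n}"
  shows "{\<omega> \<in> space M. Z i \<omega> \<in> A} \<in> sets M"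
proof -
  have "{\<omega> \<in> space M. Z i \<omega> \<in> A} = Z i -` (A \<inter> {1..Q}) \<inter> space M"
    using label_in[OF assms] by auto
  then show ?thesis using measurable_sets[OF label_measurable[OF assms], of "A \<inter> {1..Q}"] by simp
qed

lemma label_eq_measurable: "i \<in> {1..n} \<Longrightarrow> {\<omega> \<in> space M. Z i \<omega> = q} \<in> sets M"
  using label_set_measurable[of i "{q}"] by simp

lemma label_eq_conj_measurable:
  assumes "i \<in> {1..n}" "{\<omega> \<in> space M. P \<omega>} \<in> sets M"
  shows "{\<omega> \<in> space M. Z i \<omega> = q \<and> P \<omega>} \<in> sets M"
proof -
  have "{\<omega> \<in> space M. Z i \<omega> = q \<and> P \<omega>} = {\<omega> \<in> space M. Z i \<omega> = q} \<inter> {\<omega> \<in> space M. P \<omega>}"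
    by auto
  then show ?thesis using label_eq_measurable[OF assms(1)] assms(2) by simp
qed

lemma labels_event_measurable: "labels_event z \<in> sets M"
  unfolding labels_event_def by (intro sets.sets_Collect_finite_All' label_eq_measurable) (use nodes in auto)

lemma degree_measurable [measurable]:
  assumes "i \<in> {1..n}"
  shows "node_degree i \<in> borel_measurable M"
proof -
  have "(\<lambda>\<omega>. of_bool (X i j \<omega>) :: real) \<in> borel_measurable M" if "j \<in> {1..n}" for j
    using measurable_compose[OF edges_measurable[OF assms that], of of_bool borel] by simp
  then show ?thesis unfolding node_degree_def [abs_def] by (intro borel_measurable_sum) auto
qed

lemma prob_label_in:
  assumes i: "i \<in> {1..n}" and A: "A \<subseteq> {1..Q}"
  shows "prob {\<omega> \<in> space M. Z i \<omega> \<in> A} = sum \<alpha> A"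
proof -
  have "finite A" using A finite_subset by blast
  have "{\<omega> \<in> space M. Z i \<omega> \<in> A} = (\<Union>q\<in>A. {\<omega> \<in> space M. Z i \<omega> = q})" by auto
  also have "prob \<dots> = (\<Sum>q\<in>A. prob {\<omega> \<in> space M. Z i \<omega> = q})"
    using \<open>finite A\<close> label_eq_measurable[OF i]
    by (intro finite_measure_finite_Union) (auto simp: disjoint_family_on_def)
  also have "\<dots> = sum \<alpha> A" using labels_distr[OF i] A by (intro sum.cong) auto
  finally show ?thesis .
qed

lemma prob_all_labels_in:
  assumes A: "\<And>i. i \<in> {1..n} \<Longrightarrow> A i \<subseteq> {1..Q}"
  shows "prob {\<omega> \<in> space M. \<forall>i\<in>{1..n}. Z i \<omega> \<in> A i} = (\<Prod>i\<in>{1..n}. sum \<alpha> (A i))"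
proof -
  have "{\<omega> \<in> space M. \<forall>i\<in>{1..n}. Z i \<omega> \<in> A i} = (\<Inter>i\<in>{1..n}. Z i -` A i \<inter> space M)"
    using nodes by force
  also have "prob \<dots> = (\<Prod>i\<in>{1..n}. prob (Z i -` A i \<inter> space M))"
    using nodes A by (intro indep_varsD[OF labels_indep]) auto
  also have "\<dots> = (\<Prod>i\<in>{1..n}. sum \<alpha> (A i))"
  proof (intro prod.cong refl)
    fix i assume i: "i \<in> {1..n}"
    have "Z i -` A i \<inter> space M = {\<omega> \<in> space M. Z i \<omega> \<in> A i}" by auto
    then show "prob (Z i -` A i \<inter> space M) = sum \<alpha> (A i)"
      using prob_label_in[OF i A[OF i]] by simp
  qed
  finally show ?thesis .
qed

lemma prob_labels_event:
  assumes "z \<in> {1..n} \<rightarrow> {1..Q}"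
  shows "prob (labels_event z) = (\<Prod>i\<in>{1..n}. \<alpha> (z i))"
  using prob_all_labels_in[of "\<lambda>i. {z i}"] assms by (auto simp: labels_event_def Pi_iff)

text \<open>Union bound over the labels: \<open>n\<close> independent draws all miss
  \<open>q\<close> with probability \<open>(1 - \<alpha> q) ^ n\<close>. This is the second term of
  the final estimate.\<close>

lemma prob_some_label_missing_le:
  "prob {\<omega> \<in> space M. \<exists>q\<in>{1..Q}. \<forall>i\<in>{1..n}. Z i \<omega> \<noteq> q} \<le> real Q * (1 - Min (\<alpha> ` {1..Q})) ^ n"
proof -
  have missing: "{\<omega> \<in> space M. \<forall>i\<in>{1..n}. Z i \<omega> \<noteq> q}
      = {\<omega> \<in> space M. \<forall>i\<in>{1..n}. Z i \<omega> \<in> {1..Q} - {q}}" for q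
    using label_in by blast
  have "{\<omega> \<in> space M. \<exists>q\<in>{1..Q}. \<forall>i\<in>{1..n}. Z i \<omega> \<noteq> q}
      = (\<Union>q\<in>{1..Q}. {\<omega> \<in> space M. \<forall>i\<in>{1..n}. Z i \<omega> \<noteq> q})" by auto
  also have "prob \<dots> \<le> (\<Sum>q\<in>{1..Q}. prob {\<omega> \<in> space M. \<forall>i\<in>{1..n}. Z i \<omega> \<noteq> q})"
  proof (intro finite_measure_subadditive_finite)
    have "{\<omega> \<in> space M. \<forall>i\<in>{1..n}. Z i \<omega> \<noteq> q} \<in> sets M" for q
      unfolding missing by (intro sets.sets_Collect_finite_All' label_set_measurable) (use nodes in auto)
    then show "(\<lambda>q. {\<omega> \<in> space M. \<forall>i\<in>{1..n}. Z i \<omega> \<noteq> q}) ` {1..Q} \<subseteq> sets M" by blast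
  qed simp
  also have "\<dots> \<le> (\<Sum>q\<in>{1..Q}. (1 - Min (\<alpha> ` {1..Q})) ^ n)"
  proof (intro sum_mono)
    fix q assume q: "q \<in> {1..Q}"
    have "prob {\<omega> \<in> space M. \<forall>i\<in>{1..n}. Z i \<omega> \<noteq> q} = (sum \<alpha> ({1..Q} - {q})) ^ n"
      unfolding missing by (subst prob_all_labels_in) auto
    also have "\<dots> \<le> (1 - Min (\<alpha> ` {1..Q})) ^ n"
    proof (intro power_mono)
      show "sum \<alpha> ({1..Q} - {q}) \<ge> 0" using \<alpha>_nonneg by (intro sum_nonneg) auto
      have "sum \<alpha> ({1..Q} - {q}) = 1 - \<alpha> q" using q \<alpha>_sum by (simp add: sum_diff1)
      also have "\<dots> \<le> 1 - Min (\<alpha> ` {1..Q})" using q by auto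
      finally show "sum \<alpha> ({1..Q} - {q}) \<le> 1 - Min (\<alpha> ` {1..Q})" .
    qed
    finally show "prob {\<omega> \<in> space M. \<forall>i\<in>{1..n}. Z i \<omega> \<noteq> q} \<le> (1 - Min (\<alpha> ` {1..Q})) ^ n" .
  qed
  finally show ?thesis by simp
qed

section \<open>Exponential moments and tails of the degrees\<close>

text \<open>Given the labels, the edges at \<open>i\<close> are independent Bernoulli variables, so
  the moment generating function factors over the other nodes.\<close>

lemma cond_degree_mgf:
  fixes s :: real
  assumes z: "z \<in> {1..n} \<rightarrow> {1..Q}" and pos: "prob (labels_event z) > 0" and i: "i \<in> {1..n}"
  defines "N \<equiv> uniform_measure M (labels_event z)"
  shows "integrable N (\<lambda>\<omega>. exp (s * node_degree i \<omega>))"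
    and "(\<integral>\<omega>. exp (s * node_degree i \<omega>) \<partial>N) = (\<Prod>j\<in>{1..n} - {i}. 1 + \<pi> (z i) (z j) * (exp s - 1))"
proof -
  interpret N: prob_space N
    unfolding N_def using pos by (intro prob_space_uniform_measure) (auto simp: emeasure_eq_measure)
  have N_simps: "space N = space M" "sets N = sets M" by (simp_all add: N_def)
  note pos' = pos[unfolded labels_event_def]
  define J where "J = {1..n} - {i}"
  \<comment> \<open>Independence is available for increasing pairs; \<open>pr j\<close> is the edge
    between \<open>i\<close> and \<open>j\<close> in that form, and symmetry of \<open>X\<close>
    identifies it with \<open>X i j\<close>.\<close>
  define pr where "pr = (\<lambda>j. (min i j, max i j))"
  have inj: "inj_on pr J" by (auto simp: inj_on_def pr_def min_def max_def split: if_splits)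
  have pr_pairs: "pr ` J \<subseteq> {(i, j). 1 \<le> i \<and> i < j \<and> j \<le> n}"
    using i by (auto simp: pr_def J_def min_def max_def)
  define W where "W = (\<lambda>p \<omega>. exp (s * of_bool (case p of (a, b) \<Rightarrow> X a b \<omega>)) :: real)"
  have "N.indep_vars (\<lambda>_. count_space UNIV) (\<lambda>(i, j). X i j) (pr ` J)"
    using N.indep_vars_subset[OF _ pr_pairs] edges_cond_indep[OF pos']
    by (simp add: N_def labels_event_def)
  from N.indep_vars_compose2[OF this, of "\<lambda>_ x. exp (s * of_bool x)" "\<lambda>_. borel"]
  have ind: "N.indep_vars (\<lambda>_. borel) W (pr ` J)"
    by (simp add: W_def case_prod_unfold)
  have W_meas: "W p \<in> borel_measurable N" if "p \<in> pr ` J" for p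
    using ind that unfolding N.indep_vars_def by blast
  \<comment> \<open>\<open>W p\<close> takes only the values 1 and \<open>exp s\<close>.\<close>
  have int: "integrable N (W p)" if "p \<in> pr ` J" for p
    using W_meas[OF that]
    by (intro N.integrable_const_bound[where B = "max 1 (exp s)"]) (auto simp: W_def split: prod.splits)
  have prod_eq: "(\<Prod>p\<in>pr ` J. W p \<omega>) = exp (s * node_degree i \<omega>)" if "\<omega> \<in> space M" for \<omega>
  proof -
    have "(\<Prod>p\<in>pr ` J. W p \<omega>) = (\<Prod>j\<in>J. W (pr j) \<omega>)"
      using inj by (simp add: prod.reindex)
    also have "\<dots> = (\<Prod>j\<in>J. exp (s * of_bool (X i j \<omega>)))"
      using i that edges_sym
      by (intro prod.cong) (auto simp: W_def pr_def J_def min_def max_def)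
    also have "\<dots> = exp (s * node_degree i \<omega>)"
      by (simp only: node_degree_def J_def exp_sum sum_distrib_left finite_Diff finite_atLeastAtMost)
    finally show ?thesis .
  qed
  have W_int: "(\<integral>\<omega>. W (pr j) \<omega> \<partial>N) = 1 + \<pi> (z i) (z j) * (exp s - 1)" if j: "j \<in> J" for j
  proof -
    obtain a b where "pr j = (a, b)" by (cases "pr j")
    moreover have "pr j \<in> {(i, j). 1 \<le> i \<and> i < j \<and> j \<le> n}"
      by (rule subsetD[OF pr_pairs imageI[OF j]])
    ultimately have ab: "pr j = (a, b)" "1 \<le> a" "a < b" "b \<le> n" by simp_all
    \<comment> \<open>Symmetry of \<open>\<pi>\<close> undoes the reordering; the range makes the
      entry a valid Bernoulli parameter.\<close>
    have \<pi>_ab: "\<pi> (z a) (z b) = \<pi> (z i) (z j)" "\<pi> (z a) (z b) \<in> {0..1}"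
    proof -
      have zij: "z i \<in> {1..Q}" "z j \<in> {1..Q}" using z i j by (auto simp: J_def)
      have "a = i \<and> b = j \<or> a = j \<and> b = i"
        using ab(1) by (auto simp: pr_def min_def max_def split: if_splits)
      then show "\<pi> (z a) (z b) = \<pi> (z i) (z j)" "\<pi> (z a) (z b) \<in> {0..1}"
        using \<pi>_sym[OF zij] \<pi>_range[OF zij] by auto
    qed
    have X_meas: "X a b \<in> measurable N (count_space UNIV)"
      using edges_measurable[of a b] ab by (simp add: N_def)
    have "(\<integral>\<omega>. W (pr j) \<omega> \<partial>N) = (\<integral>x. exp (s * of_bool x) \<partial>distr N (count_space UNIV) (X a b))"
      using X_meas by (simp add: W_def ab integral_distr)
    also have "distr N (count_space UNIV) (X a b) = measure_pmf (bernoulli_pmf (\<pi> (z a) (z b)))"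
      unfolding N_def labels_event_def using edges_cond_distr[OF pos'] ab by blast
    also have "(\<integral>x. exp (s * of_bool x) \<partial>measure_pmf (bernoulli_pmf (\<pi> (z a) (z b))))
        = 1 + \<pi> (z i) (z j) * (exp s - 1)"
      using \<pi>_ab by (subst integral_bernoulli_pmf) (auto simp: algebra_simps)
    finally show ?thesis .
  qed
  have fin: "finite (pr ` J)" by (simp add: J_def)
  have "integrable N (\<lambda>\<omega>. \<Prod>p\<in>pr ` J. W p \<omega>)"
    by (rule N.indep_vars_integrable[OF fin ind int])
  also have "integrable N (\<lambda>\<omega>. \<Prod>p\<in>pr ` J. W p \<omega>) \<longleftrightarrow> integrable N (\<lambda>\<omega>. exp (s * node_degree i \<omega>))"
    using prod_eq by (intro Bochner_Integration.integrable_cong) (auto simp: N_simps)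
  finally show "integrable N (\<lambda>\<omega>. exp (s * node_degree i \<omega>))" .
  have "(\<integral>\<omega>. exp (s * node_degree i \<omega>) \<partial>N) = (\<integral>\<omega>. (\<Prod>p\<in>pr ` J. W p \<omega>) \<partial>N)"
    using prod_eq by (intro Bochner_Integration.integral_cong) (auto simp: N_simps)
  also have "\<dots> = (\<Prod>p\<in>pr ` J. \<integral>\<omega>. W p \<omega> \<partial>N)"
    by (rule N.indep_vars_lebesgue_integral[OF fin ind int])
  also have "\<dots> = (\<Prod>j\<in>J. 1 + \<pi> (z i) (z j) * (exp s - 1))"
    using inj W_int by (simp add: prod.reindex)
  finally show "(\<integral>\<omega>. exp (s * node_degree i \<omega>) \<partial>N) = (\<Prod>j\<in>{1..n} - {i}. 1 + \<pi> (z i) (z j) * (exp s - 1))"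
    by (simp add: J_def)
qed

text \<open>Markov's inequality for \<open>exp (s * node_degree i \<omega>)\<close> under the
  conditional law, multiplied by the probability of the condition so that null label vectors are
  covered. The sign of \<open>s\<close> is free, which includes both tails.\<close>

lemma labels_event_degree_chernoff:
  fixes s b :: real
  assumes z: "z \<in> {1..n} \<rightarrow> {1..Q}" and i: "i \<in> {1..n}"
  shows "prob (labels_event z \<inter> {\<omega> \<in> space M. s * node_degree i \<omega> \<ge> b})
    \<le> prob (labels_event z) * (exp (- b) * (\<Prod>j\<in>{1..n} - {i}. 1 + \<pi> (z i) (z j) * (exp s - 1)))"
proof (cases "prob (labels_event z) > 0")
  case True
  define N where "N = uniform_measure M (labels_event z)"
  let ?B = "{\<omega> \<in> space M. s * node_degree i \<omega> \<ge> b}"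
  have B: "?B \<in> sets M" using i by measurable
  have int: "integrable N (\<lambda>\<omega>. exp (s * node_degree i \<omega>))"
    unfolding N_def by (rule cond_degree_mgf(1)[OF z True i])
  have "measure N ?B = measure N {\<omega> \<in> space N. exp (s * node_degree i \<omega>) \<ge> exp b}"
    by (simp add: N_def)
  also have "\<dots> \<le> (\<integral>\<omega>\<in>space N. exp (s * node_degree i \<omega>) \<partial>N) / exp b"
    using int by (intro integral_Markov_inequality'_measure)
      (auto simp: set_integrable_def simp del: real_scaleR_def intro!: integrable_mult_indicator)
  also have "(\<integral>\<omega>\<in>space N. exp (s * node_degree i \<omega>) \<partial>N) = (\<integral>\<omega>. exp (s * node_degree i \<omega>) \<partial>N)"
    by (rule set_integral_space[OF int])
  also have "\<dots> = (\<Prod>j\<in>{1..n} - {i}. 1 + \<pi> (z i) (z j) * (exp s - 1))"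
    unfolding N_def by (rule cond_degree_mgf(2)[OF z True i])
  finally have "measure N ?B \<le> exp (- b) * (\<Prod>j\<in>{1..n} - {i}. 1 + \<pi> (z i) (z j) * (exp s - 1))"
    by (simp add: exp_minus field_simps)
  moreover have "measure N ?B = prob (labels_event z \<inter> ?B) / prob (labels_event z)"
    unfolding N_def using True B by (intro measure_uniform_measure) (auto simp: emeasure_eq_measure)
  ultimately show ?thesis using True by (simp add: pos_divide_le_eq mult.commute)
next
  case False
  then have "prob (labels_event z) = 0" by (simp add: zero_less_measure_iff)
  moreover have "prob (labels_event z \<inter> {\<omega> \<in> space M. s * node_degree i \<omega> \<ge> b}) \<le> prob (labels_event z)"
    by (intro finite_measure_mono labels_event_measurable) auto
  ultimately show ?thesis by simp
qed

text \<open>Averaging over the other labels: the sum over label vectors of a product is a product of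
  sums, and each of its \<open>n - 1\<close> factors is the moment generating function of
  Bernoulli(\<open>mean_conn q\<close>).\<close>

lemma class_degree_chernoff:
  fixes s b :: real
  assumes i: "i \<in> {1..n}" and q: "q \<in> {1..Q}"
  shows "prob {\<omega> \<in> space M. Z i \<omega> = q \<and> s * node_degree i \<omega> \<ge> b}
    \<le> \<alpha> q * (exp (- b) * (1 + mean_conn q * (exp s - 1)) ^ (n - 1))"
proof -
  let ?F = "{1..n} \<rightarrow>\<^sub>E {1..Q}"
  let ?D = "{\<omega> \<in> space M. s * node_degree i \<omega> \<ge> b}"
  let ?g = "\<lambda>r. 1 + \<pi> q r * (exp s - 1)"
  \<comment> \<open>The constraint \<open>z i = q\<close> moves into the factor of node
    \<open>i\<close>, which vanishes otherwise, so the sum can run over all of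
    \<open>?F\<close>.\<close>
  define f where "f = (\<lambda>j r. if j = i then (if r = q then \<alpha> q else 0) else \<alpha> r * ?g r)"
  have fin: "finite ?F" by (intro finite_PiE) auto
  have D: "?D \<in> sets M" using i by measurable
  have "{\<omega> \<in> space M. Z i \<omega> = q \<and> s * node_degree i \<omega> \<ge> b}
      \<subseteq> (\<Union>z\<in>{z\<in>?F. z i = q}. labels_event z \<inter> ?D)"
  proof
    fix \<omega> assume \<omega>: "\<omega> \<in> {\<omega> \<in> space M. Z i \<omega> = q \<and> s * node_degree i \<omega> \<ge> b}"
    \<comment> \<open>The default value outside \<open>{1..n}\<close> places the vector in the
      finite set \<open>?F\<close>.\<close>
    define z where "z = restrict (\<lambda>j. Z j \<omega>) {1..n}"
    have "z \<in> ?F" "z i = q" "\<omega> \<in> labels_event z"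
      using \<omega> i label_in[of _ \<omega>] by (auto simp: z_def labels_event_def)
    then show "\<omega> \<in> (\<Union>z\<in>{z\<in>?F. z i = q}. labels_event z \<inter> ?D)" using \<omega> by blast
  qed
  then have "prob {\<omega> \<in> space M. Z i \<omega> = q \<and> s * node_degree i \<omega> \<ge> b}
      \<le> prob (\<Union>z\<in>{z\<in>?F. z i = q}. labels_event z \<inter> ?D)"
    using fin labels_event_measurable D by (intro finite_measure_mono sets.finite_UN) auto
  also have "\<dots> \<le> (\<Sum>z\<in>{z\<in>?F. z i = q}. prob (labels_event z \<inter> ?D))"
    using fin labels_event_measurable D by (intro finite_measure_subadditive_finite) auto
  also have "\<dots> \<le> (\<Sum>z\<in>{z\<in>?F. z i = q}. exp (- b) * (\<Prod>j\<in>{1..n}. f j (z j)))"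
  proof (intro sum_mono)
    fix z assume "z \<in> {z\<in>?F. z i = q}"
    then have z: "z \<in> {1..n} \<rightarrow> {1..Q}" "z i = q" by (auto simp: PiE_def)
    have "prob (labels_event z \<inter> ?D) \<le> prob (labels_event z) * (exp (- b) * (\<Prod>j\<in>{1..n} - {i}. ?g (z j)))"
      using labels_event_degree_chernoff[OF z(1) i, of b s] z(2) by simp
    also have "prob (labels_event z) = \<alpha> q * (\<Prod>j\<in>{1..n} - {i}. \<alpha> (z j))"
      using prob_labels_event[OF z(1)] i z(2) by (simp add: prod.remove[of _ i])
    also have "\<alpha> q * (\<Prod>j\<in>{1..n} - {i}. \<alpha> (z j)) * (exp (- b) * (\<Prod>j\<in>{1..n} - {i}. ?g (z j)))
        = exp (- b) * (\<alpha> q * (\<Prod>j\<in>{1..n} - {i}. \<alpha> (z j) * ?g (z j)))"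
      by (simp only: prod.distrib mult_ac)
    also have "\<alpha> q * (\<Prod>j\<in>{1..n} - {i}. \<alpha> (z j) * ?g (z j)) = (\<Prod>j\<in>{1..n}. f j (z j))"
      using i z(2) by (simp add: prod.remove[of _ i] f_def)
    finally show "prob (labels_event z \<inter> ?D) \<le> exp (- b) * (\<Prod>j\<in>{1..n}. f j (z j))" .
  qed
  also have "\<dots> = (\<Sum>z\<in>?F. exp (- b) * (\<Prod>j\<in>{1..n}. f j (z j)))"
  proof (intro sum.mono_neutral_left fin ballI)
    fix z assume "z \<in> ?F - {z\<in>?F. z i = q}"
    then have "f i (z i) = 0" by (auto simp: f_def)
    then show "exp (- b) * (\<Prod>j\<in>{1..n}. f j (z j)) = 0"
      using i by (auto simp: prod_zero_iff)
  qed auto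
  also have "\<dots> = exp (- b) * (\<Prod>j\<in>{1..n}. \<Sum>r\<in>{1..Q}. f j r)"
    by (simp add: prod_sum_PiE sum_distrib_left)
  also have "(\<Prod>j\<in>{1..n}. \<Sum>r\<in>{1..Q}. f j r)
      = \<alpha> q * (\<Prod>j\<in>{1..n} - {i}. \<Sum>r\<in>{1..Q}. \<alpha> r * ?g r)"
    using i q by (simp add: prod.remove[of _ i] f_def)
  also have "(\<Sum>r\<in>{1..Q}. \<alpha> r * ?g r) = 1 + mean_conn q * (exp s - 1)"
    using \<alpha>_sum by (simp add: mean_connectivity_def sum.distrib distrib_left sum_distrib_right mult.assoc)
  also have "(\<Prod>j\<in>{1..n} - {i}. 1 + mean_conn q * (exp s - 1)) = (1 + mean_conn q * (exp s - 1)) ^ (n - 1)"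
    using i by simp
  finally show ?thesis by (simp add: mult_ac)
qed

lemma mean_conn_range:
  assumes "q \<in> {1..Q}"
  shows "mean_conn q \<in> {0..1}"
proof -
  have "mean_conn q \<ge> 0" unfolding mean_connectivity_def
    using assms \<alpha>_nonneg \<pi>_range by (intro sum_nonneg mult_nonneg_nonneg) auto
  moreover have "mean_conn q \<le> (\<Sum>r\<in>{1..Q}. \<alpha> r * 1)" unfolding mean_connectivity_def
    using assms \<alpha>_nonneg \<pi>_range by (intro sum_mono mult_left_mono) auto
  ultimately show ?thesis using \<alpha>_sum by simp
qed

text \<open>Each tail is bounded at its own tilt, and only the sum of the two exponentials is
  compared with the target. The factor \<open>\<alpha> q\<close> is kept for the later sum over
  classes.\<close>

lemma class_degree_deviation:
  assumes i: "i \<in> {1..n}" and q: "q \<in> {1..Q}" and e: "0 \<le> e" "e \<le> 1/4"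
    and large: "(real n - 1) * e\<^sup>2 \<ge> 3/2"
  shows "prob {\<omega> \<in> space M. Z i \<omega> = q \<and> \<bar>node_degree i \<omega> / (real n - 1) - mean_conn q\<bar> \<ge> e}
    \<le> \<alpha> q * (2 * exp (- 2 * real n * e\<^sup>2))"
proof -
  define m where "m = real n - 1"
  have m: "m > 0" "real (n - 1) = m" using nodes by (auto simp: m_def)
  define p where "p = mean_conn q"
  have p: "0 \<le> p" "p \<le> 1" using mean_conn_range[OF q] by (auto simp: p_def)
  define s where "s = bernoulli_tilt p e"
  \<comment> \<open>The lower tail of the degree is the upper tail of the number of absent edges,
    whose success probability is \<open>1 - p\<close>.\<close>
  define t where "t = bernoulli_tilt (1 - p) e"
  have st: "s \<ge> 0" "t \<ge> 0" using bernoulli_tilt_nonneg[OF e(1)] by (auto simp: s_def t_def)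
  define U where "U = {\<omega> \<in> space M. Z i \<omega> = q \<and> s * node_degree i \<omega> \<ge> m * (s * (p + e))}"
  define L where "L = {\<omega> \<in> space M. Z i \<omega> = q \<and> (- t) * node_degree i \<omega> \<ge> m * (- t * (p - e))}"
  have meas: "{\<omega> \<in> space M. Z i \<omega> = q \<and> b \<le> c * node_degree i \<omega>} \<in> sets M" for b c :: real
    by (rule label_eq_conj_measurable[OF i]) (use i in measurable)
  \<comment> \<open>Since \<open>m = real (n - 1)\<close>, the exponent spreads over the trials and
    the estimate reduces to a single-trial factor.\<close>
  have power_exp: "exp (- (m * a)) = exp (- a) ^ (n - 1)" for a
  proof -
    have "exp (real (n - 1) * (- a)) = exp (- a) ^ (n - 1)" by (rule exp_of_nat_mult)
    then show ?thesis unfolding m(2) by (simp only: mult_minus_right)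
  qed
  have sub: "{\<omega> \<in> space M. Z i \<omega> = q \<and> \<bar>node_degree i \<omega> / m - p\<bar> \<ge> e} \<subseteq> U \<union> L"
  proof
    fix \<omega> assume \<omega>: "\<omega> \<in> {\<omega> \<in> space M. Z i \<omega> = q \<and> \<bar>node_degree i \<omega> / m - p\<bar> \<ge> e}"
    then have "\<bar>node_degree i \<omega> / m - p\<bar> \<ge> e" by blast
    then consider "node_degree i \<omega> / m \<ge> p + e" | "node_degree i \<omega> / m \<le> p - e"
      by linarith
    then show "\<omega> \<in> U \<union> L"
    proof cases
      case 1
      then have "m * (p + e) \<le> node_degree i \<omega>" using m by (simp add: pos_le_divide_eq mult.commute)
      from mult_left_mono[OF this st(1)] show ?thesis using \<omega> by (simp add: U_def mult_ac)
    next
      case 2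
      then have "node_degree i \<omega> \<le> m * (p - e)" using m by (simp add: pos_divide_le_eq mult.commute)
      from mult_left_mono[OF this st(2)] show ?thesis using \<omega> by (simp add: L_def mult_ac)
    qed
  qed
  have mgf_nonneg: "0 \<le> 1 + p * (exp a - 1)" for a :: real
  proof -
    have eq: "1 + p * (exp a - 1) = (1 - p) + p * exp a" by (simp add: algebra_simps)
    show ?thesis unfolding eq using p by simp
  qed
  have "prob U \<le> \<alpha> q * (exp (- (s * (p + e))) * (1 + p * (exp s - 1))) ^ (n - 1)"
    using class_degree_chernoff[OF i q, of "m * (s * (p + e))" s]
    unfolding U_def p_def[symmetric] power_exp power_mult_distrib .
  also have "\<dots> \<le> \<alpha> q * exp (- bernoulli_rate p e) ^ (n - 1)"
    using bernoulli_mgf_bound[OF p e(1)] \<alpha>_nonneg[OF q] mgf_nonneg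
    by (intro mult_left_mono power_mono) (auto simp: s_def)
  finally have U: "prob U \<le> \<alpha> q * exp (- m * bernoulli_rate p e)"
    using power_exp[of "bernoulli_rate p e"] by simp
  have "prob L \<le> \<alpha> q * (exp (- (- t * (p - e))) * (1 + p * (exp (- t) - 1))) ^ (n - 1)"
    using class_degree_chernoff[OF i q, of "m * (- t * (p - e))" "- t"]
    unfolding L_def p_def[symmetric] power_exp power_mult_distrib .
  \<comment> \<open>Moving a factor \<open>exp t\<close> into the second bracket exchanges success
    and failure and so brings in \<open>1 - p\<close>.\<close>
  also have "exp (- (- t * (p - e))) * (1 + p * (exp (- t) - 1))
      = exp (- t * (1 - p + e)) * (1 + (1 - p) * (exp t - 1))"
  proof -
    have "- (- t * (p - e)) = - t * (1 - p + e) + t" by (simp add: algebra_simps)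
    then have "exp (- (- t * (p - e))) = exp (- t * (1 - p + e)) * exp t" by (simp only: exp_add)
    then have "exp (- (- t * (p - e))) * (1 + p * (exp (- t) - 1))
        = exp (- t * (1 - p + e)) * (exp t * (1 + p * (exp (- t) - 1)))"
      by (simp only: mult.assoc)
    also have "exp t * (1 + p * (exp (- t) - 1)) = exp t + p * (exp t * exp (- t)) - p * exp t"
      by (simp only: ring_distribs mult_ac mult_1_right right_diff_distrib)
    also have "\<dots> = 1 + (1 - p) * (exp t - 1)"
      by (simp add: exp_minus_inverse) (simp add: algebra_simps)
    finally show ?thesis .
  qed
  also have "\<alpha> q * (exp (- t * (1 - p + e)) * (1 + (1 - p) * (exp t - 1))) ^ (n - 1)
      \<le> \<alpha> q * exp (- bernoulli_rate (1 - p) e) ^ (n - 1)"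
  proof (intro mult_left_mono power_mono)
    show "exp (- t * (1 - p + e)) * (1 + (1 - p) * (exp t - 1)) \<le> exp (- bernoulli_rate (1 - p) e)"
      unfolding t_def using p e by (intro bernoulli_mgf_bound) auto
    have eq: "1 + (1 - p) * (exp t - 1) = p + (1 - p) * exp t" by (simp add: algebra_simps)
    show "0 \<le> exp (- t * (1 - p + e)) * (1 + (1 - p) * (exp t - 1))" unfolding eq using p by simp
  qed (use \<alpha>_nonneg[OF q] in auto)
  finally have L: "prob L \<le> \<alpha> q * exp (- m * bernoulli_rate (1 - p) e)"
    using power_exp[of "bernoulli_rate (1 - p) e"] by simp
  have UL: "U \<in> sets M" "L \<in> sets M" unfolding U_def L_def by (rule meas)+
  have "prob {\<omega> \<in> space M. Z i \<omega> = q \<and> \<bar>node_degree i \<omega> / m - p\<bar> \<ge> e} \<le> prob (U \<union> L)"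
    using sub UL by (intro finite_measure_mono) auto
  also have "\<dots> \<le> prob U + prob L" using UL by (rule measure_Un_le)
  also have "\<dots> \<le> \<alpha> q * (exp (- m * bernoulli_rate p e) + exp (- m * bernoulli_rate (1 - p) e))"
    unfolding distrib_left using U L by (rule add_mono)
  \<comment> \<open>Here \<open>m + 1 = real n\<close>: the lost trial is recovered.\<close>
  also have "\<dots> \<le> \<alpha> q * (2 * exp (- 2 * (m + 1) * e\<^sup>2))"
    using large \<alpha>_nonneg[OF q] e by (intro mult_left_mono two_sided_rate_bound) (auto simp: m_def)
  finally show ?thesis by (simp add: m_def p_def)
qed

lemma deviation_event_measurable:
  assumes i: "i \<in> {1..n}"
  shows "{\<omega> \<in> space M. \<bar>node_degree i \<omega> / (real n - 1) - mean_conn (Z i \<omega>)\<bar> \<ge> e} \<in> sets M"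
proof -
  have "(\<lambda>\<omega>. mean_conn (Z i \<omega>)) \<in> borel_measurable M"
    using measurable_compose[OF label_measurable[OF i], of mean_conn borel] by simp
  then show ?thesis using i by measurable
qed

text \<open>Splitting by the label of \<open>i\<close> loses no factor \<open>Q\<close>, because the
  weights \<open>\<alpha> q\<close> sum to 1.\<close>

lemma degree_deviation:
  assumes i: "i \<in> {1..n}" and e: "0 \<le> e" "e \<le> 1/4" and large: "(real n - 1) * e\<^sup>2 \<ge> 3/2"
  shows "prob {\<omega> \<in> space M. \<bar>node_degree i \<omega> / (real n - 1) - mean_conn (Z i \<omega>)\<bar> \<ge> e}
    \<le> 2 * exp (- 2 * real n * e\<^sup>2)"
proof -
  define E where "E = (\<lambda>q. {\<omega> \<in> space M. Z i \<omega> = q \<and> \<bar>node_degree i \<omega> / (real n - 1) - mean_conn q\<bar> \<ge> e})"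
  have E: "E q \<in> sets M" for q
    unfolding E_def
    by (rule label_eq_conj_measurable[OF i]) (use i in measurable)
  have "{\<omega> \<in> space M. \<bar>node_degree i \<omega> / (real n - 1) - mean_conn (Z i \<omega>)\<bar> \<ge> e} \<subseteq> (\<Union>q\<in>{1..Q}. E q)"
    using label_in[OF i] unfolding E_def by blast
  then have "prob {\<omega> \<in> space M. \<bar>node_degree i \<omega> / (real n - 1) - mean_conn (Z i \<omega>)\<bar> \<ge> e}
      \<le> prob (\<Union>q\<in>{1..Q}. E q)"
    using E by (intro finite_measure_mono) auto
  also have "\<dots> \<le> (\<Sum>q\<in>{1..Q}. prob (E q))"
    using E by (intro finite_measure_subadditive_finite) auto
  also have "\<dots> \<le> (\<Sum>q\<in>{1..Q}. \<alpha> q * (2 * exp (- 2 * real n * e\<^sup>2)))"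
    unfolding E_def using class_degree_deviation[OF i _ e large] by (intro sum_mono) auto
  also have "\<dots> = 2 * exp (- 2 * real n * e\<^sup>2)"
    using \<alpha>_sum by (simp only: sum_distrib_right[symmetric] mult_1_left)
  finally show ?thesis .
qed

text \<open>The case split is on the full bound with its factor \<open>n\<close>: a value below 1
  gives the lower bound on \<open>(real n - 1) * e\<^sup>2\<close> and then a union bound over the
  nodes, while a value of at least 1 bounds any probability.\<close>

lemma some_degree_deviation:
  assumes e: "0 \<le> e" "e \<le> 1/4"
  shows "prob {\<omega> \<in> space M. \<exists>i\<in>{1..n}. \<bar>node_degree i \<omega> / (real n - 1) - mean_conn (Z i \<omega>)\<bar> \<ge> e}
    \<le> 2 * real n * exp (- 2 * real n * e\<^sup>2)"
proof (cases "2 * real n * exp (- 2 * real n * e\<^sup>2) < 1")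
  case True
  then have large: "(real n - 1) * e\<^sup>2 \<ge> 3/2"
    using nodes e by (intro mult_square_ge_of_tail_nontrivial)
  define E where "E = (\<lambda>i. {\<omega> \<in> space M. \<bar>node_degree i \<omega> / (real n - 1) - mean_conn (Z i \<omega>)\<bar> \<ge> e})"
  have "{\<omega> \<in> space M. \<exists>i\<in>{1..n}. \<bar>node_degree i \<omega> / (real n - 1) - mean_conn (Z i \<omega>)\<bar> \<ge> e}
      = (\<Union>i\<in>{1..n}. E i)" by (auto simp: E_def)
  also have "prob \<dots> \<le> (\<Sum>i\<in>{1..n}. prob (E i))"
    using deviation_event_measurable by (intro finite_measure_subadditive_finite) (auto simp: E_def)
  also have "\<dots> \<le> (\<Sum>i\<in>{1..n}. 2 * exp (- 2 * real n * e\<^sup>2))"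
    unfolding E_def using degree_deviation[OF _ e large] by (intro sum_mono) auto
  finally show ?thesis by simp
next
  case False
  then show ?thesis by (meson prob_le_1 order_trans linorder_not_less)
qed

end

section \<open>Separation of the means and the final bound\<close>

lemma min_separation_le:
  assumes "q \<in> {1..Q}" "r \<in> {1..Q}" "q \<noteq> r"
  shows "min_separation Q \<pi> \<alpha> \<le> \<bar>mean_connectivity Q \<pi> \<alpha> q - mean_connectivity Q \<pi> \<alpha> r\<bar>"
proof -
  let ?f = "\<lambda>(q, r). \<bar>mean_connectivity Q \<pi> \<alpha> q - mean_connectivity Q \<pi> \<alpha> r\<bar>"
  have "finite {\<bar>mean_connectivity Q \<pi> \<alpha> q - mean_connectivity Q \<pi> \<alpha> r\<bar> | q r.
      q \<in> {1..Q} \<and> r \<in> {1..Q} \<and> q \<noteq> r}"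
    by (rule finite_subset[of _ "?f ` ({1..Q} \<times> {1..Q})"]) auto
  then show ?thesis unfolding min_separation_def using assms by (intro Min_le) auto
qed

lemma min_separation_nonneg:
  assumes "Q \<ge> 2"
  shows "min_separation Q \<pi> \<alpha> \<ge> 0"
proof -
  let ?f = "\<lambda>(q, r). \<bar>mean_connectivity Q \<pi> \<alpha> q - mean_connectivity Q \<pi> \<alpha> r\<bar>"
  let ?S = "{\<bar>mean_connectivity Q \<pi> \<alpha> q - mean_connectivity Q \<pi> \<alpha> r\<bar> | q r.
      q \<in> {1..Q} \<and> r \<in> {1..Q} \<and> q \<noteq> r}"
  have "finite ?S" by (rule finite_subset[of _ "?f ` ({1..Q} \<times> {1..Q})"]) auto
  \<comment> \<open>Two labels exist, so the minimum is attained and inherits its sign from an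
    absolute value.\<close>
  moreover have "1 \<in> {1..Q}" "2 \<in> {1..Q}" "1 \<noteq> (2 :: nat)" using assms by auto
  then have "?S \<noteq> {}" by blast
  ultimately have "Min ?S \<in> ?S" by (rule Min_in)
  then show ?thesis unfolding min_separation_def by auto
qed

text \<open>\<open>LG\<close> is an arbitrary measurable selection of admissible outputs, so all
  measurable tie-breaking is covered; failure \<open>None\<close> counts as an error.\<close>

theorem theorem2p2:
  fixes M :: "'w measure"
    and n Q :: nat
    and \<pi> :: "nat \<Rightarrow> nat \<Rightarrow> real"
    and \<alpha> :: "nat \<Rightarrow> real"
    and Z :: "nat \<Rightarrow> 'w \<Rightarrow> nat"
    and X :: "nat \<Rightarrow> nat \<Rightarrow> 'w \<Rightarrow> bool"
    and LG :: "'w \<Rightarrow> nat set set option"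
    and \<delta> \<alpha>\<^sub>0 :: real
  assumes "Q \<ge> 2" and "n \<ge> 2"
    and "\<And>q. q \<in> {1..Q} \<Longrightarrow> \<alpha> q \<ge> 0" and "(\<Sum>q\<in>{1..Q}. \<alpha> q) = 1"
    and "\<And>q r. q \<in> {1..Q} \<Longrightarrow> r \<in> {1..Q} \<Longrightarrow> \<pi> q r \<in> {0..1}"
    and "\<And>q r. q \<in> {1..Q} \<Longrightarrow> r \<in> {1..Q} \<Longrightarrow> \<pi> q r = \<pi> r q"
    and "\<And>q r. q \<in> {1..Q} \<Longrightarrow> r \<in> {1..Q} \<Longrightarrow> q \<noteq> r \<Longrightarrow>
      mean_connectivity Q \<pi> \<alpha> q \<noteq> mean_connectivity Q \<pi> \<alpha> r"
    and "\<delta> = min_separation Q \<pi> \<alpha>"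
    and "\<alpha>\<^sub>0 = Min (\<alpha> ` {1..Q})"
    and "stochastic_block_model M n Q \<pi> \<alpha> Z X"
    and "LG \<in> measurable M (count_space UNIV)"
    and "\<And>\<omega>. \<omega> \<in> space M \<Longrightarrow> LG_output n Q (\<lambda>i j. X i j \<omega>) (LG \<omega>)"
  shows "measure M {\<omega> \<in> space M. LG \<omega> \<noteq> Some (true_partition n Q (\<lambda>i. Z i \<omega>))}
    \<le> 2 * real n * exp (- (1 / 8) * real n * \<delta>\<^sup>2) + real Q * (1 - \<alpha>\<^sub>0) ^ n"
proof -
  interpret stochastic_block_model M n Q \<pi> \<alpha> Z X by fact
  interpret sbm_parameters M n Q \<pi> \<alpha> Z X
    by unfold_locales (fact assms)+
  \<comment> \<open>With a quarter of the separation, distinct means are \<open>4 * e\<close> apart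
    and \<open>2 * e\<^sup>2\<close> equals \<open>\<delta>\<^sup>2 / 8\<close>.\<close>
  define e where "e = \<delta> / 4"
  have sep: "\<bar>mean_conn q - mean_conn r\<bar> \<ge> 4 * e"
    if "q \<in> {1..Q}" "r \<in> {1..Q}" "q \<noteq> r" for q r
    using min_separation_le[OF that] assms(8) by (simp add: e_def)
  have e_nonneg: "e \<ge> 0" using min_separation_nonneg[OF assms(1)] assms(8) by (simp add: e_def)
  \<comment> \<open>Means lie in the unit interval, so two of them differ by at most 1.\<close>
  have e_le: "e \<le> 1/4"
  proof -
    have Q: "1 \<in> {1..Q}" "2 \<in> {1..Q}" using \<open>Q \<ge> 2\<close> by auto
    have "4 * e \<le> \<bar>mean_conn 1 - mean_conn 2\<bar>" using Q by (intro sep) auto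
    then show ?thesis
      using mean_conn_range[OF Q(1)] mean_conn_range[OF Q(2)] unfolding atLeastAtMost_iff by linarith
  qed
  define B1 where "B1 = {\<omega> \<in> space M. \<exists>q\<in>{1..Q}. \<forall>i\<in>{1..n}. Z i \<omega> \<noteq> q}"
  define B2 where "B2 = {\<omega> \<in> space M. \<exists>i\<in>{1..n}.
    \<bar>node_degree i \<omega> / (real n - 1) - mean_conn (Z i \<omega>)\<bar> \<ge> e}"
  have "B1 = (\<Union>q\<in>{1..Q}. {\<omega> \<in> space M. \<forall>i\<in>{1..n}. Z i \<omega> \<in> - {q}})"
    by (auto simp: B1_def)
  also have "\<dots> \<in> sets M"
    by (intro sets.finite_UN sets.sets_Collect_finite_All' label_set_measurable) (use nodes in auto)
  finally have B1: "B1 \<in> sets M" .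
  have "B2 = (\<Union>i\<in>{1..n}. {\<omega> \<in> space M. \<bar>node_degree i \<omega> / (real n - 1) - mean_conn (Z i \<omega>)\<bar> \<ge> e})"
    by (auto simp: B2_def)
  also have "\<dots> \<in> sets M" by (intro sets.finite_UN deviation_event_measurable) auto
  finally have B2: "B2 \<in> sets M" .
  have "{\<omega> \<in> space M. LG \<omega> \<noteq> Some (true_partition n Q (\<lambda>i. Z i \<omega>))} \<subseteq> B2 \<union> B1"
  proof (rule subsetI, rule ccontr)
    fix \<omega> assume "\<omega> \<in> {\<omega> \<in> space M. LG \<omega> \<noteq> Some (true_partition n Q (\<lambda>i. Z i \<omega>))}"
    then have \<omega>: "\<omega> \<in> space M" "LG \<omega> \<noteq> Some (true_partition n Q (\<lambda>i. Z i \<omega>))" by auto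
    assume "\<omega> \<notin> B2 \<union> B1"
    then have all: "\<And>q. q \<in> {1..Q} \<Longrightarrow> \<exists>i\<in>{1..n}. Z i \<omega> = q"
      and close: "\<And>i. i \<in> {1..n} \<Longrightarrow> \<bar>normalized_degree n (\<lambda>i j. X i j \<omega>) i - mean_conn (Z i \<omega>)\<bar> < e"
      using \<omega>(1) by (auto simp: B1_def B2_def normalized_degree_eq not_le)
    \<comment> \<open>If every label occurs then \<open>Q \<le> n\<close>; the failing case
      \<open>n < Q\<close> thus lies inside \<open>B1\<close>.\<close>
    have "{1..Q} \<subseteq> (\<lambda>i. Z i \<omega>) ` {1..n}" using all by blast
    then have "card {1..Q} \<le> card {1..n}" by (rule surj_card_le[OF finite_atLeastAtMost])
    then have "\<not> n < Q" by simp
    then obtain P where P: "LG \<omega> = Some P" "LG_partition n Q (\<lambda>i j. X i j \<omega>) P"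
      using assms(12)[OF \<omega>(1)] unfolding LG_output_def by auto
    have "P = true_partition n Q (\<lambda>i. Z i \<omega>)"
      using P(2) \<open>Q \<ge> 2\<close> label_in[OF _ \<omega>(1)] all sep close by (rule LG_partition_eq_true_partition)
    then show False using P(1) \<omega>(2) by simp
  qed
  then have "prob {\<omega> \<in> space M. LG \<omega> \<noteq> Some (true_partition n Q (\<lambda>i. Z i \<omega>))} \<le> prob (B2 \<union> B1)"
    using B1 B2 by (intro finite_measure_mono) auto
  also have "\<dots> \<le> prob B2 + prob B1" using B2 B1 by (rule measure_Un_le)
  also have "prob B2 \<le> 2 * real n * exp (- 2 * real n * e\<^sup>2)"
    unfolding B2_def by (rule some_degree_deviation[OF e_nonneg e_le])
  also have "- 2 * real n * e\<^sup>2 = - (1 / 8) * real n * \<delta>\<^sup>2"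
    by (simp add: e_def power2_eq_square)
  also have "prob B1 \<le> real Q * (1 - \<alpha>\<^sub>0) ^ n"
    unfolding B1_def assms(9) by (rule prob_some_label_missing_le)
  finally show ?thesis by simp
qed

end
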